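(* For every graphon $W:\Omega\times\Omega\to[0,1]$ on an atomless Borel probability space $(\Omega,\nu)$ we have $$\chi_{\mathrm{frac}}(W)=\lim_{b\to\infty}\frac{\chi_b(W)}{b}=\inf_{b\in\mathbb N}\frac{\chi_b(W)}{b}.$$
   Context: A graphon is a symmetric measurable $W:\Omega\times\Omega\to[0,1]$. A measurable set $A$ is independent in $W$ if $W=0$ a.e. on $A\times A$; $\mathcal I(W)$ is the set of independent sets and $\mathcal I_x(W)$ those containing $x$. A fractional coloring of $W$ is $c:\mathcal I(W)\to[0,1]$ with $\sum_{I\in\mathcal I_x(W)}c(I)\ge1$ for almost every $x$; $\chi_{\mathrm{frac}}(W)$ is the infimum of $\sum_{I\in\mathcal I(W)}c(I)$ over fractional colorings. For $b\in\mathbb N$, a $b$-fold coloring of $W$ with $k$ colors is a measurable map $p:\Omega\to\binom{[k]}{b}$ such that for almost all $(x,y)\in\Omega^2$, $W(x,y)=0$ or $p(x)\cap p(y)=\emptyset$; $\chi_b(W)$ is the smallest $k$ for which such a coloring exists ($\infty$ if none). *)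

theory Defs
  imports "HOL-Probability.Probability"
begin

text \<open>
  Borel probability spaces are standard Borel: the sigma-algebra is the Borel sigma-algebra of
  some Polish topology on the underlying set.
\<close>

definition standard_borel :: "'a measure \<Rightarrow> bool" where
  "standard_borel M \<longleftrightarrow>
     (\<exists>T. completely_metrizable_space T \<and> second_countable T \<and>
          topspace T = space M \<and> sets M = sigma_sets (space M) {U. openin T U})"

definition atomless :: "'a measure \<Rightarrow> bool" where
  "atomless M \<longleftrightarrow>
     (\<forall>A\<in>sets M. emeasure M A > 0 \<longrightarrow>
        (\<exists>B\<in>sets M. B \<subseteq> A \<and> 0 < emeasure M B \<and> emeasure M B < emeasure M A))"

definition graphon :: "'a measure \<Rightarrow> ('a \<times> 'a \<Rightarrow> real) \<Rightarrow> bool" where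
  "graphon M W \<longleftrightarrow>
     W \<in> borel_measurable (M \<Otimes>\<^sub>M M) \<and>
     (\<forall>x\<in>space M. \<forall>y\<in>space M. W (x, y) = W (y, x)) \<and>
     (\<forall>x\<in>space M. \<forall>y\<in>space M. 0 \<le> W (x, y) \<and> W (x, y) \<le> 1)"

definition indep_sets_of :: "'a measure \<Rightarrow> ('a \<times> 'a \<Rightarrow> real) \<Rightarrow> 'a set set" where
  "indep_sets_of M W =
     {A \<in> sets M. AE z in M \<Otimes>\<^sub>M M. z \<in> A \<times> A \<longrightarrow> W z = 0}"

definition indep_sets_at :: "'a measure \<Rightarrow> ('a \<times> 'a \<Rightarrow> real) \<Rightarrow> 'a \<Rightarrow> 'a set set" where
  "indep_sets_at M W x = {I \<in> indep_sets_of M W. x \<in> I}"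

text \<open>
  The sums range over possibly uncountable families of independent sets and are taken in
  \<^typ>\<open>ennreal\<close>, where \<^const>\<open>infsum\<close> is the supremum of the finite partial sums.
  The values of \<open>c\<close> outside the independent sets are irrelevant.
\<close>

definition fractional_coloring ::
    "'a measure \<Rightarrow> ('a \<times> 'a \<Rightarrow> real) \<Rightarrow> ('a set \<Rightarrow> real) \<Rightarrow> bool" where
  "fractional_coloring M W c \<longleftrightarrow>
     (\<forall>I\<in>indep_sets_of M W. 0 \<le> c I \<and> c I \<le> 1) \<and>
     (AE x in M. (\<Sum>\<^sub>\<infinity>I\<in>indep_sets_at M W x. ennreal (c I)) \<ge> 1)"

definition chi_frac :: "'a measure \<Rightarrow> ('a \<times> 'a \<Rightarrow> real) \<Rightarrow> ennreal" where
  "chi_frac M W =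
     (INF c\<in>{c. fractional_coloring M W c}. \<Sum>\<^sub>\<infinity>I\<in>indep_sets_of M W. ennreal (c I))"

definition fold_coloring ::
    "'a measure \<Rightarrow> ('a \<times> 'a \<Rightarrow> real) \<Rightarrow> nat \<Rightarrow> nat \<Rightarrow> ('a \<Rightarrow> nat set) \<Rightarrow> bool" where
  "fold_coloring M W b k p \<longleftrightarrow>
     p \<in> measurable M (count_space {B. B \<subseteq> {1..k} \<and> card B = b}) \<and>
     (AE (x, y) in M \<Otimes>\<^sub>M M. W (x, y) = 0 \<or> p x \<inter> p y = {})"

text \<open>The infimum in \<^typ>\<open>enat\<close> is the least such \<open>k\<close>, and \<open>\<infinity>\<close> if there is none.\<close>

definition chi_fold :: "'a measure \<Rightarrow> ('a \<times> 'a \<Rightarrow> real) \<Rightarrow> nat \<Rightarrow> enat" where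
  "chi_fold M W b = (INF k\<in>{k. \<exists>p. fold_coloring M W b k p}. enat k)"

end

theory Submission
  imports Defs
begin

text \<open>
  The colour classes of a \<open>b\<close>-fold colouring, each weighted \<open>1 / b\<close>, form a fractional
  colouring. Conversely, a fractional colouring of finite total weight is, uniformly in the point,
  nearly exhausted by finitely many independent sets. After rescaling these weights, replace each
  weight \<open>w\<close> by \<open>\<lceil>b w\<rceil>\<close> colours; the rounding costs a bounded number of colours, which is
  negligible after division by \<open>b\<close>.
\<close>

section \<open>Infinite sums with values in \<open>ennreal\<close>\<close>

lemma infsum_ennreal_split_finite:
  fixes f :: "'a \<Rightarrow> ennreal"
  assumes "finite F" "F \<subseteq> A"
  shows "infsum f A = sum f F + infsum f (A - F)"
proof -
  have "infsum f (F \<union> (A - F)) = infsum f F + infsum f (A - F)"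
    by (intro infsum_Un_disjoint nonneg_summable_on_complete) auto
  then show ?thesis using assms by (simp add: Un_absorb1)
qed

text \<open>The sum is the supremum of its finite partial sums, so some partial sum exceeds
  \<open>infsum f A - \<epsilon>\<close>. This needs that difference to be strictly below
  \<open>infsum f A\<close>, which fails for a zero sum; that case is treated apart.\<close>

lemma infsum_ennreal_tail_less:
  fixes f :: "'a \<Rightarrow> ennreal"
  assumes fin: "infsum f A < top" and "\<epsilon> > 0"
  obtains F where "finite F" "F \<subseteq> A" "infsum f (A - F) < \<epsilon>"
proof (cases "infsum f A = 0")
  case True
  then show ?thesis using that[of "{}"] \<open>\<epsilon> > 0\<close> by simp
next
  case False
  then have "infsum f A - \<epsilon> < infsum f A"
    using fin \<open>\<epsilon> > 0\<close> by (intro ennreal_between) (auto simp: zero_less_iff_neq_zero)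
  then obtain F where F: "finite F" "F \<subseteq> A" "infsum f A - \<epsilon> < sum f F"
    unfolding nonneg_infsum_complete[of A f, simplified] less_SUP_iff by auto
  have split: "infsum f A = sum f F + infsum f (A - F)"
    by (rule infsum_ennreal_split_finite) (use F in auto)
  have "sum f F < top"
    using fin split by (auto simp: top.not_eq_extremum[symmetric])
  have "infsum f A < sum f F + \<epsilon>"
    using F(3) by (simp add: ennreal_le_minus_iff flip: not_le)
  then have "infsum f (A - F) < \<epsilon>"
    unfolding split using ennreal_add_left_cancel_less by blast
  then show ?thesis using F that by blast
qed

section \<open>From finite families of independent sets to fold colorings\<close>

lemma (in sigma_finite_measure) AE_pair_fst_snd:
  assumes "AE x in M. P x"
  shows "AE z in M \<Otimes>\<^sub>M M. P (fst z) \<and> P (snd z)"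
proof -
  interpret pair_sigma_finite M M ..
  obtain N where N: "N \<in> null_sets M" "{x \<in> space M. \<not> P x} \<subseteq> N"
    using assms by (auto simp: eventually_ae_filter)
  have [measurable]: "N \<in> sets M" using N by auto
  have "AE x in M. x \<notin> N" using N(1) by (rule AE_not_in)
  then have "AE x in M. AE y in M. fst (x, y) \<notin> N \<and> snd (x, y) \<notin> N" by auto
  then have "AE z in M \<Otimes>\<^sub>M M. fst z \<notin> N \<and> snd z \<notin> N"
    by (intro AE_pair_measure) measurable
  then show ?thesis
    using AE_space by eventually_elim (use N(2) in \<open>auto simp: space_pair_measure\<close>)
qed

text \<open>Each point chooses \<open>b\<close> of the indices of the sets that contain it. Two
  points sharing the color \<open>j\<close> both lie in \<open>A j\<close>, where \<open>W\<close>
  vanishes almost everywhere. The family is indexed by colors, so that a set may occur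
  repeatedly.\<close>

lemma (in prob_space) fold_coloring_of_cover:
  assumes indep: "\<And>j. j \<in> {1..k} \<Longrightarrow> A j \<in> indep_sets_of M W"
    and cover: "AE x in M. b \<le> card {j \<in> {1..k}. x \<in> A j}"
  shows "\<exists>p. fold_coloring M W b k p"
proof -
  define q where "q x = {j \<in> {1..k}. x \<in> A j}" for x
  \<comment> \<open>The arbitrary choice does not hurt measurability: it is applied after
    \<open>q\<close>, which is measurable and takes finitely many values.\<close>
  define g where "g S = (SOME T. T \<subseteq> S \<and> card T = b)" for S :: "nat set"
  \<comment> \<open>The default \<open>{1..b}\<close> serves the null set of insufficiently covered
    points, since \<open>p\<close> must have values of size \<open>b\<close> everywhere.\<close>
  define G where "G S = (if b \<le> card S then g S else {1..b})" for S
  define p where "p = G \<circ> q"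
  have g: "g S \<subseteq> S \<and> card (g S) = b" if "b \<le> card S" for S
    unfolding g_def using obtain_subset_with_card_n[OF that] by (rule someI2_ex) blast
  \<comment> \<open>A property that holds almost everywhere in a probability space holds at some
    point. The resulting bound \<open>b \<le> k\<close> makes the default \<open>{1..b}\<close> a
    legal value.\<close>
  have "\<exists>x. b \<le> card (q x)"
    using eventually_happens[OF cover] by (auto simp: q_def ae_filter_eq_bot_iff emeasure_space_1)
  moreover have "card (q x) \<le> card {1..k}" for x
    by (intro card_mono) (auto simp: q_def)
  ultimately have "b \<le> k" by (metis card_atLeastAtMost diff_Suc_1 le_trans)
  have "q \<in> measurable M (count_space (Pow {1..k}))"
  proof (subst measurable_count_space_eq2, simp, intro conjI ballI)
    show "q \<in> space M \<rightarrow> Pow {1..k}" by (auto simp: q_def)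
    fix S assume S: "S \<in> Pow {1..k}"
    have "q x = S \<longleftrightarrow> (\<forall>j\<in>{1..k}. x \<in> A j \<longleftrightarrow> j \<in> S)" for x
      using S unfolding q_def by blast
    then have "q -` {S} \<inter> space M = {x \<in> space M. \<forall>j\<in>{1..k}. x \<in> A j \<longleftrightarrow> j \<in> S}"
      by auto
    also have "\<dots> \<in> sets M"
    proof (rule sets.sets_Collect_finite_All)
      fix j assume "j \<in> {1..k}"
      then have [measurable]: "A j \<in> sets M"
        using indep by (auto simp: indep_sets_of_def)
      show "{x \<in> space M. x \<in> A j \<longleftrightarrow> j \<in> S} \<in> sets M" by measurable
    qed simp
    finally show "q -` {S} \<inter> space M \<in> sets M" .
  qed
  moreover have "G \<in> measurable (count_space (Pow {1..k}))
      (count_space {B. B \<subseteq> {1..k} \<and> card B = b})"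
    using g \<open>b \<le> k\<close> unfolding measurable_count_space_eq1 G_def
    by (simp add: Pi_iff) blast
  ultimately have "p \<in> measurable M (count_space {B. B \<subseteq> {1..k} \<and> card B = b})"
    unfolding p_def by (rule measurable_comp)
  moreover have "AE (x, y) in M \<Otimes>\<^sub>M M. W (x, y) = 0 \<or> p x \<inter> p y = {}"
  proof -
    have "AE z in M \<Otimes>\<^sub>M M. \<forall>j\<in>{1..k}. z \<in> A j \<times> A j \<longrightarrow> W z = 0"
      using indep by (intro AE_finite_allI) (auto simp: indep_sets_of_def)
    moreover have "AE z in M \<Otimes>\<^sub>M M. b \<le> card (q (fst z)) \<and> b \<le> card (q (snd z))"
      using cover unfolding q_def by (rule AE_pair_fst_snd)
    ultimately show ?thesis
    proof eventually_elim
      case (elim z)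
      obtain x y where z: "z = (x, y)" by force
      have "p x \<subseteq> q x" "p y \<subseteq> q y"
        using elim(2) g by (auto simp: p_def G_def z)
      then show ?case using elim(1) unfolding z q_def by blast
    qed
  qed
  ultimately show ?thesis unfolding fold_coloring_def by blast
qed

lemma bij_betw_Collect_comp:
  "bij_betw h A B \<Longrightarrow> bij_betw h {i \<in> A. P (h i)} {y \<in> B. P y}"
  by (auto simp: bij_betw_def inj_on_def)

text \<open>The colors are \<open>m I\<close> copies of each \<open>I\<close>, that is, the pairs in
  \<open>C\<close>, renumbered from 1 by \<open>h\<close>.\<close>

lemma (in prob_space) fold_coloring_of_multiplicities:
  assumes "finite F" "F \<subseteq> indep_sets_of M W"
    and cover: "AE x in M. b \<le> (\<Sum>I\<in>{I \<in> F. x \<in> I}. m I)"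
  shows "\<exists>p. fold_coloring M W b (\<Sum>I\<in>F. m I) p"
proof -
  define C where "C = Sigma F (\<lambda>I. {..<m I})"
  have fin: "finite C" using assms(1) by (auto simp: C_def)
  have card_C: "card C = (\<Sum>I\<in>F. m I)" using assms(1) by (simp add: C_def)
  obtain h where h: "bij_betw h {1..card C} C"
    using ex_bij_betw_nat_finite_1[OF fin] by blast
  have "card {j \<in> {1..card C}. x \<in> fst (h j)} = (\<Sum>I\<in>{I \<in> F. x \<in> I}. m I)" for x
  proof -
    have "bij_betw h {j \<in> {1..card C}. x \<in> fst (h j)} {i \<in> C. x \<in> fst i}"
      using h by (rule bij_betw_Collect_comp)
    then have "card {j \<in> {1..card C}. x \<in> fst (h j)} = card {i \<in> C. x \<in> fst i}"
      by (rule bij_betw_same_card)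
    also have "{i \<in> C. x \<in> fst i} = Sigma {I \<in> F. x \<in> I} (\<lambda>I. {..<m I})"
      by (auto simp: C_def)
    finally show ?thesis using assms(1) by simp
  qed
  moreover have "fst (h j) \<in> indep_sets_of M W" if "j \<in> {1..card C}" for j
    using bij_betwE[OF h] that assms(2) by (fastforce simp: C_def)
  ultimately show ?thesis
    using fold_coloring_of_cover[of "card C" "\<lambda>j. fst (h j)" W b] cover by (simp add: card_C)
qed

section \<open>From fold colorings to fractional colorings\<close>

lemma fold_coloring_indep_sets:
  assumes "fold_coloring M W b k p"
  shows "{x \<in> space M. i \<in> p x} \<in> indep_sets_of M W"
proof -
  have p: "p \<in> measurable M (count_space {B. B \<subseteq> {1..k} \<and> card B = b})"
    and ae: "AE (x, y) in M \<Otimes>\<^sub>M M. W (x, y) = 0 \<or> p x \<inter> p y = {}"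
    using assms by (auto simp: fold_coloring_def)
  have "p -` {B. B \<subseteq> {1..k} \<and> card B = b \<and> i \<in> B} \<inter> space M \<in> sets M"
    using p by (rule measurable_sets) auto
  also have "p -` {B. B \<subseteq> {1..k} \<and> card B = b \<and> i \<in> B} \<inter> space M = {x \<in> space M. i \<in> p x}"
    using measurable_space[OF p] by auto
  finally show ?thesis
    using ae by (auto simp: indep_sets_of_def elim!: eventually_mono)
qed

lemma chi_frac_le_fold_coloring:
  assumes p: "fold_coloring M W b k p" and "b \<ge> 1"
  shows "chi_frac M W \<le> of_nat k / of_nat b"
proof -
  define A where "A i = {x \<in> space M. i \<in> p x}" for i
  \<comment> \<open>Distinct colors can have the same class, while \<open>c\<close> is a function of
    the set; so the weight \<open>1 / b\<close> is multiplied by the number of colors with class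
    \<open>I\<close>.\<close>
  define n where "n I = card {i \<in> {1..k}. A i = I}" for I
  \<comment> \<open>The empty colour class can occur more than \<open>b\<close> times, so its weight has to be dropped to
    keep all weights at most 1.\<close>
  define c where "c I = (if I = {} then 0 else real (n I) / real b)" for I
  have "p x \<in> {B. B \<subseteq> {1..k} \<and> card B = b}" if "x \<in> space M" for x
    using p that unfolding fold_coloring_def by (metis measurable_space space_count_space)
  then have px: "p x \<subseteq> {1..k}" "card (p x) = b" if "x \<in> space M" for x
    using that by blast+
  have A_indep: "A i \<in> indep_sets_of M W" for i
    unfolding A_def using p by (rule fold_coloring_indep_sets)
  have c_le_1: "c I \<le> 1" for I
  proof (cases "\<exists>i\<in>{1..k}. A i = I \<and> I \<noteq> {}")
    case True
    then obtain x where x: "x \<in> I" "x \<in> space M" by (auto simp: A_def)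
    \<comment> \<open>Every color with class \<open>I\<close> belongs to \<open>p x\<close> for a
      single point \<open>x\<close> of \<open>I\<close>, and \<open>p x\<close> has only
      \<open>b\<close> elements.\<close>
    then have "{i \<in> {1..k}. A i = I} \<subseteq> p x" by (auto simp: A_def)
    then have "n I \<le> b"
      unfolding n_def using px[OF x(2)] card_mono finite_subset by (metis finite_atLeastAtMost)
    then show ?thesis using \<open>b \<ge> 1\<close> by (simp add: c_def)
  next
    case False
    then have "I = {} \<or> {i \<in> {1..k}. A i = I} = {}" by auto
    then have "I = {} \<or> n I = 0" unfolding n_def by (metis card.empty)
    then show ?thesis by (auto simp: c_def)
  qed
  have c_nn: "0 \<le> c I" for I by (simp add: c_def)
  have "1 \<le> (\<Sum>\<^sub>\<infinity>I\<in>indep_sets_at M W x. ennreal (c I))" if x: "x \<in> space M" for x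
  proof -
    have fin: "finite (p x)" using px(1)[OF x] finite_subset by blast
    have sub: "A ` p x \<subseteq> indep_sets_at M W x"
      using x A_indep by (auto simp: indep_sets_at_def A_def)
    have "real b = (\<Sum>i\<in>p x. 1)" using px(2)[OF x] by simp
    also have "\<dots> = (\<Sum>I\<in>A ` p x. \<Sum>i\<in>{i \<in> p x. A i = I}. 1)"
      by (rule sum.image_gen[OF fin])
    also have "\<dots> = (\<Sum>I\<in>A ` p x. real (card {i \<in> p x. A i = I}))" by simp
    also have "\<dots> \<le> (\<Sum>I\<in>A ` p x. real (n I))"
      using px(1)[OF x] by (intro sum_mono) (auto simp: n_def intro!: card_mono)
    \<comment> \<open>All these classes contain \<open>x\<close>, so none of them is the empty set,
      whose weight was dropped.\<close>
    also have "\<dots> = (\<Sum>I\<in>A ` p x. b * c I)"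
      using x \<open>b \<ge> 1\<close> by (intro sum.cong) (auto simp: c_def A_def)
    finally have "b * 1 \<le> b * (\<Sum>I\<in>A ` p x. c I)" by (simp add: sum_distrib_left)
    then have "1 \<le> (\<Sum>I\<in>A ` p x. c I)" using \<open>b \<ge> 1\<close> by simp
    then have "1 \<le> ennreal (\<Sum>I\<in>A ` p x. c I)" by simp
    also have "\<dots> = (\<Sum>I\<in>A ` p x. ennreal (c I))"
      using c_nn by (intro sum_ennreal[symmetric])
    also have "\<dots> \<le> (\<Sum>\<^sub>\<infinity>I\<in>indep_sets_at M W x. ennreal (c I))"
      using infsum_ennreal_split_finite[OF _ sub, of "\<lambda>I. ennreal (c I)"] fin by simp
    finally show ?thesis .
  qed
  then have "fractional_coloring M W c"
    unfolding fractional_coloring_def using c_nn c_le_1 by auto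
  then have "chi_frac M W \<le> (\<Sum>\<^sub>\<infinity>I\<in>indep_sets_of M W. ennreal (c I))"
    unfolding chi_frac_def by (intro INF_lower) simp
  also have "\<dots> = (\<Sum>\<^sub>\<infinity>I\<in>A ` {1..k}. ennreal (c I))"
  proof (rule infsum_cong_neutral)
    fix I assume "I \<in> indep_sets_of M W - A ` {1..k}"
    then have "{i \<in> {1..k}. A i = I} = {}" by auto
    then have "n I = 0" by (simp only: n_def card.empty)
    then show "ennreal (c I) = 0" by (simp add: c_def)
  qed (use A_indep in auto)
  also have "\<dots> = ennreal (\<Sum>I\<in>A ` {1..k}. c I)"
    using c_nn by (simp add: sum_ennreal)
  also have "\<dots> \<le> ennreal (real k / real b)"
  proof (rule ennreal_leI)
    have "(\<Sum>I\<in>A ` {1..k}. c I) \<le> (\<Sum>I\<in>A ` {1..k}. real (n I) / b)"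
      by (intro sum_mono) (auto simp: c_def)
    also have "\<dots> = (\<Sum>I\<in>A ` {1..k}. \<Sum>i\<in>{i \<in> {1..k}. A i = I}. 1) / b"
      by (simp add: n_def sum_divide_distrib)
    also have "\<dots> = (\<Sum>i\<in>{1..k}. 1) / b"
      by (subst sum.image_gen[of "{1..k}" _ A]) auto
    finally show "(\<Sum>I\<in>A ` {1..k}. c I) \<le> real k / real b" by simp
  qed
  also have "\<dots> = of_nat k / of_nat b"
    using \<open>b \<ge> 1\<close> by (simp add: divide_ennreal ennreal_of_nat_eq_real_of_nat)
  finally show ?thesis .
qed

section \<open>Rounding a fractional coloring\<close>

text \<open>Truncating to a finite family lowers the covering weight from 1 to \<delta>, and
  division by \<delta> restores it. The constant \<open>N\<close> is the size of that family, which
  is fixed before \<open>b\<close>; this bounds the rounding error uniformly.\<close>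

lemma (in prob_space) fold_coloring_of_fractional:
  assumes c: "fractional_coloring M W c"
    and s: "(\<Sum>\<^sub>\<infinity>I\<in>indep_sets_of M W. ennreal (c I)) = ennreal s" "s \<ge> 0"
    and \<delta>: "0 < \<delta>" "\<delta> < 1"
  obtains N :: nat where "\<And>b. \<exists>k p. fold_coloring M W b k p \<and> real k \<le> b * (s / \<delta>) + N"
proof -
  let ?I = "indep_sets_of M W" and ?f = "\<lambda>I. ennreal (c I)"
  have c_nn: "c I \<ge> 0" if "I \<in> ?I" for I
    using c that by (auto simp: fractional_coloring_def)
  obtain F where F: "finite F" "F \<subseteq> ?I" and tail: "infsum ?f (?I - F) < ennreal (1 - \<delta>)"
    using infsum_ennreal_tail_less[of ?f ?I "ennreal (1 - \<delta>)"] s \<delta> by auto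
  have "ennreal (\<Sum>I\<in>F. c I) = sum ?f F"
    using F c_nn by (intro sum_ennreal[symmetric]) auto
  also have "\<dots> \<le> ennreal s"
    unfolding s(1)[symmetric] infsum_ennreal_split_finite[OF F] by simp
  finally have sum_F: "(\<Sum>I\<in>F. c I) \<le> s"
    using s(2) by simp
  have cover: "AE x in M. \<delta> \<le> (\<Sum>I\<in>{I \<in> F. x \<in> I}. c I)"
  proof -
    have "AE x in M. (\<Sum>\<^sub>\<infinity>I\<in>indep_sets_at M W x. ?f I) \<ge> 1"
      using c by (auto simp: fractional_coloring_def)
    then show ?thesis
    proof eventually_elim
      case (elim x)
      let ?Fx = "{I \<in> F. x \<in> I}"
      have Fx: "finite ?Fx" "?Fx \<subseteq> indep_sets_at M W x"
        using F by (auto simp: indep_sets_at_def)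
      have "1 \<le> sum ?f ?Fx + infsum ?f (indep_sets_at M W x - ?Fx)"
        using elim infsum_ennreal_split_finite[OF Fx] by simp
      \<comment> \<open>The discarded sets through \<open>x\<close> are among all the discarded
        sets, so one tail bound serves every \<open>x\<close>.\<close>
      also have "infsum ?f (indep_sets_at M W x - ?Fx) \<le> infsum ?f (?I - F)"
        by (intro infsum_mono_neutral nonneg_summable_on_complete) (auto simp: indep_sets_at_def)
      also have "\<dots> \<le> ennreal (1 - \<delta>)" using tail by simp
      also have "sum ?f ?Fx = ennreal (\<Sum>I\<in>?Fx. c I)"
        using F c_nn by (intro sum_ennreal) auto
      finally have "1 \<le> ennreal ((\<Sum>I\<in>?Fx. c I) + (1 - \<delta>))"
        using F c_nn \<delta> by (subst ennreal_plus) (auto intro!: sum_nonneg simp: add_left_mono)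
      then show ?case by simp
    qed
  qed
  have "\<exists>k p. fold_coloring M W b k p \<and> real k \<le> b * (s / \<delta>) + card F" for b
  proof -
    \<comment> \<open>Rounding up keeps the cover and costs at most one extra color per set in
      \<open>F\<close>.\<close>
    define m where "m I = nat \<lceil>b * c I / \<delta>\<rceil>" for I
    have m: "b * c I / \<delta> \<le> m I" "m I \<le> b * c I / \<delta> + 1" if "I \<in> F" for I
    proof -
      have "0 \<le> b * c I / \<delta>" using that F c_nn \<delta> by auto
      then show "b * c I / \<delta> \<le> m I" "m I \<le> b * c I / \<delta> + 1"
        unfolding m_def by linarith+
    qed
    have "AE x in M. b \<le> (\<Sum>I\<in>{I \<in> F. x \<in> I}. m I)"
      using cover
    proof eventually_elim
      case (elim x)
      have "real b \<le> b / \<delta> * (\<Sum>I\<in>{I \<in> F. x \<in> I}. c I)"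
        using mult_left_mono[OF elim, of "b / \<delta>"] \<delta> by simp
      also have "\<dots> = (\<Sum>I\<in>{I \<in> F. x \<in> I}. b * c I / \<delta>)"
        by (simp add: sum_distrib_left)
      also have "\<dots> \<le> (\<Sum>I\<in>{I \<in> F. x \<in> I}. real (m I))"
        using m by (intro sum_mono) auto
      finally show ?case by (simp flip: of_nat_sum)
    qed
    then obtain p where "fold_coloring M W b (\<Sum>I\<in>F. m I) p"
      using fold_coloring_of_multiplicities[OF F] by blast
    moreover have "real (\<Sum>I\<in>F. m I) \<le> b * (s / \<delta>) + card F"
    proof -
      have "real (\<Sum>I\<in>F. m I) \<le> (\<Sum>I\<in>F. b * c I / \<delta> + 1)"
        using m by (auto intro: sum_mono)
      also have "\<dots> = b / \<delta> * (\<Sum>I\<in>F. c I) + card F"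
        by (simp add: sum.distrib sum_distrib_left)
      also have "\<dots> \<le> b / \<delta> * s + card F"
        using sum_F \<delta> by (intro add_right_mono mult_left_mono) auto
      finally show ?thesis by simp
    qed
    ultimately show ?thesis by blast
  qed
  then show ?thesis by (rule that)
qed

section \<open>Comparison of the two chromatic numbers and passage to the limit\<close>

lemma chi_frac_le_chi_fold:
  assumes "b \<ge> 1"
  shows "chi_frac M W \<le> ennreal_of_enat (chi_fold M W b) / of_nat b"
proof (cases "\<exists>k p. fold_coloring M W b k p")
  case True
  \<comment> \<open>Since \<open>enat\<close> is well-ordered, the infimum is attained by an actual
    coloring.\<close>
  then have "chi_fold M W b \<in> enat ` {k. \<exists>p. fold_coloring M W b k p}"
    unfolding chi_fold_def by (elim exE) (rule wellorder_InfI, blast)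
  then show ?thesis using chi_frac_le_fold_coloring[OF _ assms] by auto
next
  case False
  then have "chi_fold M W b = \<infinity>" by (simp add: chi_fold_def top_enat_def)
  then show ?thesis by (simp add: ennreal_top_divide)
qed

text \<open>A coloring of total weight \<open>s < a\<close> gives quotients at most
  \<open>s / \<delta> + N / b\<close>. First \<delta> is taken close to 1, which fixes
  \<open>N\<close>; then \<open>b\<close> grows.\<close>

lemma (in prob_space) eventually_chi_fold_less:
  assumes "chi_frac M W < a"
  shows "\<forall>\<^sub>F b in sequentially. ennreal_of_enat (chi_fold M W b) / of_nat b < a"
proof -
  let ?sum = "\<lambda>c. \<Sum>\<^sub>\<infinity>I\<in>indep_sets_of M W. ennreal (c I)"
  obtain c where c: "fractional_coloring M W c" "?sum c < a"
    using assms unfolding chi_frac_def INF_less_iff by auto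
  obtain s where s: "?sum c = ennreal s" "s \<ge> 0"
    using c(2) by (cases "?sum c") auto
  \<comment> \<open>A finite bound \<open>u\<close> strictly between \<open>s\<close> and
    \<open>a\<close> lets the estimates run in the reals, even if \<open>a\<close> is
    infinite.\<close>
  obtain v where "ennreal s < v" "v < a"
    using c(2) s(1) dense by metis
  then obtain u where u: "ennreal s < ennreal u" "ennreal u < a"
    by (cases v) auto
  then have "s < u" using s(2) by (simp add: ennreal_less_iff)
  have "((\<lambda>\<delta>. s / \<delta>) \<longlongrightarrow> s / 1) (at_left (1::real))"
    by (intro tendsto_intros) auto
  then have "\<forall>\<^sub>F \<delta> in at_left 1. s / \<delta> < u"
    using \<open>s < u\<close> by (auto dest: order_tendstoD)
  moreover have "\<forall>\<^sub>F \<delta> in at_left (1::real). \<delta> \<in> {0<..<1}"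
    by (rule eventually_at_left_real) simp
  ultimately have "\<forall>\<^sub>F \<delta> in at_left 1. s / \<delta> < u \<and> \<delta> \<in> {0<..<1}" by (rule eventually_conj)
  then obtain \<delta> where \<delta>: "s / \<delta> < u" "0 < \<delta>" "\<delta> < 1"
    by (metis (no_types, lifting) eventually_happens' greaterThanLessThan_iff
        trivial_limit_at_left_real)
  obtain N where N: "\<And>b. \<exists>k p. fold_coloring M W b k p \<and> real k \<le> b * (s / \<delta>) + N"
    using fold_coloring_of_fractional[OF c(1) s \<delta>(2,3)] by metis
  have "(\<lambda>b. s / \<delta> + N / real b) \<longlonglongrightarrow> s / \<delta> + 0"
    by (intro tendsto_intros lim_const_over_n)
  then have "\<forall>\<^sub>F b in sequentially. s / \<delta> + N / real b < u"
    using \<delta>(1) by (auto dest: order_tendstoD)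
  then show ?thesis
    using eventually_gt_at_top[of 0]
  proof eventually_elim
    case (elim b)
    obtain k p where k: "fold_coloring M W b k p" "real k \<le> b * (s / \<delta>) + N"
      using N by blast
    have "chi_fold M W b \<le> enat k"
      unfolding chi_fold_def using k(1) by (intro INF_lower) auto
    then have "ennreal_of_enat (chi_fold M W b) / of_nat b \<le> of_nat k / of_nat b"
      by (intro divide_right_mono_ennreal) (metis ennreal_of_enat_enat ennreal_of_enat_le_iff)
    also have "\<dots> = ennreal (real k / real b)"
      using elim by (simp add: divide_ennreal ennreal_of_nat_eq_real_of_nat)
    also have "real k / real b \<le> s / \<delta> + N / real b"
      using k(2) elim \<delta>(2) by (simp add: field_simps)
    then have "ennreal (real k / real b) \<le> ennreal u"
      using elim by (intro ennreal_leI) simp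
    also note u(2)
    finally show ?case .
  qed
qed

theorem theorem4p12:
  fixes M :: "'a measure" and W :: "'a \<times> 'a \<Rightarrow> real"
  assumes "prob_space M" and "standard_borel M" and "atomless M"
    and "graphon M W"
  shows "((\<lambda>b. ennreal_of_enat (chi_fold M W b) / of_nat b) \<longlonglongrightarrow> chi_frac M W) \<and>
         chi_frac M W = (INF b\<in>{1..}. ennreal_of_enat (chi_fold M W b) / of_nat b)"
proof
  interpret prob_space M by fact
  let ?r = "\<lambda>b. ennreal_of_enat (chi_fold M W b) / of_nat b"
  show lim: "?r \<longlonglongrightarrow> chi_frac M W"
  proof (rule order_tendstoI)
    fix a assume a: "a < chi_frac M W"
    show "\<forall>\<^sub>F b in sequentially. a < ?r b"
      using eventually_ge_at_top[of 1]
      by eventually_elim (rule less_le_trans[OF a chi_frac_le_chi_fold])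
  qed (rule eventually_chi_fold_less)
  show "chi_frac M W = (INF b\<in>{1..}. ?r b)"
  proof (rule antisym)
    show "chi_frac M W \<le> (INF b\<in>{1..}. ?r b)"
      by (intro INF_greatest chi_frac_le_chi_fold) simp
    \<comment> \<open>The infimum bounds the quotients from \<open>b = 1\<close> on, hence also
      their limit, which does not depend on the quotient at 0.\<close>
    show "(INF b\<in>{1..}. ?r b) \<le> chi_frac M W"
      using lim by (rule tendsto_lowerbound)
        (auto simp: eventually_at_top_linorder intro!: exI[of _ 1] INF_lower)
  qed
qed

end
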